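(* Let $\mathscr{A}=\{A_1,\ldots,A_m\}$ be an irreducible set of real $d\times d$ matrices with $\rho=\rho(\mathscr{A})>0$, let $\|\cdot\|$ be some extremal norm for $\mathscr{A}$ on $\mathbb{R}^d$, and let $S=\{x\in\mathbb{R}^d:\|x\|\le 1\}$ be its unit ball. Then the sequence of bodies \[ M_0=S,\qquad M_{n+1}=\frac{1}{\rho}\operatorname{conv}\Bigl(\bigcup_{i}A_iM_n\Bigr),\qquad n=0,1,\ldots, \] is monotonically decreasing ($M_{n+1}\subseteq M_n$ for all $n\ge 0$) and converges, in the Hausdorff metric, to some Dranishnikov--Konyagin body of $\mathscr{A}$.
   Context: A set $\mathscr{A}$ of real $d\times d$ matrices is irreducible if the matrices from $\mathscr{A}$ have no common invariant subspace other than $\{0\}$ and $\mathbb{R}^d$. The joint spectral radius is $\rho(\mathscr{A})=\limsup_{n\to\infty}\max_{\sigma\in\{1,\ldots,m\}^n}\|A_{\sigma_n}\cdots A_{\sigma_1}\|^{1/n}$; it does not depend on the norm. A norm $\|\cdot\|$ on $\mathbb{R}^d$ is extremal for $\mathscr{A}$ if $\max_i\|A_ix\|\le\rho(\mathscr{A})\|x\|$ for all $x\in\mathbb{R}^d$. A convex body is a compact convex subset of $\mathbb{R}^d$ with nonempty interior. A Dranishnikov--Konyagin body of $\mathscr{A}$ is a convex body $M$ such that $\rho M=\operatorname{conv}\bigl(\bigcup_i A_iM\bigr)$ for some $\rho>0$. *)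

theory Defs
  imports "HOL-Analysis.Analysis"
begin

text \<open>
  A finite set \<open>{A\<^sub>1, ..., A\<^sub>m}\<close> of real \<open>d\<times>d\<close> matrices is given by a family \<open>A\<close> of matrices
  with indices in \<open>{1..m}\<close>.
\<close>

definition irreducible_matrices :: "(real^'d^'d) set \<Rightarrow> bool" where
  "irreducible_matrices \<A> \<longleftrightarrow>
     (\<forall>V. subspace V \<and> (\<forall>B\<in>\<A>. (\<lambda>x. B *v x) ` V \<subseteq> V) \<longrightarrow> V = {0} \<or> V = UNIV)"

text \<open>\<open>matrix_word A [s\<^sub>1, ..., s\<^sub>n]\<close> is \<open>A s\<^sub>n ** ... ** A s\<^sub>1\<close>: the first letter acts first.\<close>

primrec matrix_word :: "(nat \<Rightarrow> real^'d^'d) \<Rightarrow> nat list \<Rightarrow> real^'d^'d" where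
  "matrix_word A [] = mat 1"
| "matrix_word A (s # ss) = matrix_word A ss ** A s"

text \<open>
  The matrix norm is the operator norm induced by the Euclidean norm; the joint spectral radius
  does not depend on this choice. The limes superior is taken in the extended reals; for
  \<open>m \<ge> 1\<close> it is finite because the operator norm is submultiplicative.
\<close>

definition joint_spectral_radius :: "nat \<Rightarrow> (nat \<Rightarrow> real^'d^'d) \<Rightarrow> real" where
  "joint_spectral_radius m A = real_of_ereal (limsup (\<lambda>n. ereal
     (Max ((\<lambda>\<sigma>. root n (onorm (\<lambda>x. matrix_word A \<sigma> *v x)))
             ` {\<sigma>. length \<sigma> = n \<and> set \<sigma> \<subseteq> {1..m}}))))"

text \<open>Norms other than the Euclidean norm of the type class.\<close>

definition is_norm :: "('a::real_vector \<Rightarrow> real) \<Rightarrow> bool" where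
  "is_norm N \<longleftrightarrow>
     (\<forall>x. 0 \<le> N x) \<and> (\<forall>x. N x = 0 \<longleftrightarrow> x = 0) \<and>
     (\<forall>c x. N (c *\<^sub>R x) = \<bar>c\<bar> * N x) \<and> (\<forall>x y. N (x + y) \<le> N x + N y)"

definition extremal_norm :: "nat \<Rightarrow> (nat \<Rightarrow> real^'d^'d) \<Rightarrow> (real^'d \<Rightarrow> real) \<Rightarrow> bool" where
  "extremal_norm m A N \<longleftrightarrow> is_norm N \<and>
     (\<forall>x. Max ((\<lambda>i. N (A i *v x)) ` {1..m}) \<le> joint_spectral_radius m A * N x)"

definition convex_body :: "'a::euclidean_space set \<Rightarrow> bool" where
  "convex_body M \<longleftrightarrow> compact M \<and> convex M \<and> interior M \<noteq> {}"

definition conv_images :: "nat \<Rightarrow> (nat \<Rightarrow> real^'d^'d) \<Rightarrow> (real^'d) set \<Rightarrow> (real^'d) set" where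
  "conv_images m A M = convex hull (\<Union>i\<in>{1..m}. (\<lambda>x. A i *v x) ` M)"

definition DK_body :: "nat \<Rightarrow> (nat \<Rightarrow> real^'d^'d) \<Rightarrow> (real^'d) set \<Rightarrow> bool" where
  "DK_body m A M \<longleftrightarrow> convex_body M \<and> (\<exists>r>0. (\<lambda>x. r *\<^sub>R x) ` M = conv_images m A M)"

primrec body_seq ::
  "nat \<Rightarrow> (nat \<Rightarrow> real^'d^'d) \<Rightarrow> (real^'d \<Rightarrow> real) \<Rightarrow> nat \<Rightarrow> (real^'d) set" where
  "body_seq m A N 0 = {x. N x \<le> 1}"
| "body_seq m A N (Suc n) =
     (\<lambda>x. (1 / joint_spectral_radius m A) *\<^sub>R x) ` conv_images m A (body_seq m A N n)"

text \<open>A metric on nonempty compact sets; the suprema are meaningful for nonempty bounded sets only.\<close>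

definition hausdorff_dist :: "'a::metric_space set \<Rightarrow> 'a set \<Rightarrow> real" where
  "hausdorff_dist S T = max (SUP x\<in>S. infdist x T) (SUP y\<in>T. infdist y S)"

end

theory Submission
  imports Defs
begin

text \<open>
  Extremality gives \<open>M\<^sub>1 \<subseteq> M\<^sub>0\<close>, hence the sequence decreases and converges to \<open>M = \<Inter>\<^sub>n M\<^sub>n\<close>; the
  equation \<open>\<rho> M = conv (\<Union>\<^sub>i A\<^sub>i M)\<close> follows since \<open>conv (\<Union>\<^sub>i A\<^sub>i M\<^sub>n)\<close> lies in a small neighbourhood
  of \<open>conv (\<Union>\<^sub>i A\<^sub>i M)\<close> as soon as \<open>M\<^sub>n\<close> lies in a small neighbourhood of \<open>M\<close>. A convex set
  containing the origin has nonempty interior iff it spans the space, and by irreducibility the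
  span of \<open>M\<close>, being invariant, is the whole space unless \<open>M = {0}\<close>. In the latter case some
  \<open>M\<^sub>n\<close> would lie in half the unit ball, so that all products of length \<open>n\<close> would contract the
  extremal norm by \<open>\<rho>\<^sup>n / 2\<close>, and the joint spectral radius would be less than \<open>\<rho>\<close>.
\<close>

section \<open>Arbitrary norms on Euclidean space\<close>

lemma is_normD:
  assumes "is_norm N"
  shows "0 \<le> N x" "N x = 0 \<longleftrightarrow> x = 0" "N (c *\<^sub>R x) = \<bar>c\<bar> * N x" "N (x + y) \<le> N x + N y"
  using assms unfolding is_norm_def by blast+

lemma is_norm_convex_on:
  assumes "is_norm N"
  shows "convex_on UNIV N"
proof (rule convex_onI)
  fix t :: real and x y :: 'a
  assume t: "0 < t" "t < 1"
  have "N ((1 - t) *\<^sub>R x + t *\<^sub>R y) \<le> N ((1 - t) *\<^sub>R x) + N (t *\<^sub>R y)"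
    by (rule is_normD(4)[OF assms])
  then show "N ((1 - t) *\<^sub>R x + t *\<^sub>R y) \<le> (1 - t) * N x + t * N y"
    using t by (simp add: is_normD(3)[OF assms])
qed auto

text \<open>A finite convex function on an open set in finite dimension is continuous.\<close>

lemma is_norm_continuous_on:
  fixes N :: "'a::euclidean_space \<Rightarrow> real"
  assumes "is_norm N"
  shows "continuous_on S N"
proof -
  have "continuous_on UNIV N"
    using convex_on_continuous[OF open_UNIV is_norm_convex_on[OF assms]] .
  then show ?thesis
    by (rule continuous_on_subset) simp
qed

text \<open>Compactness of the Euclidean unit sphere provides the extrema of \<open>N\<close> there,
  and homogeneity carries them over to all vectors.\<close>

lemma is_norm_equivalent_norm:
  fixes N :: "'a::euclidean_space \<Rightarrow> real"
  assumes N: "is_norm N"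
  obtains a b where "0 < a" "0 < b" "\<And>x. a * norm x \<le> N x" "\<And>x. N x \<le> b * norm x"
proof -
  let ?S = "sphere 0 1 :: 'a set"
  have ne: "?S \<noteq> {}" by simp
  obtain u where u: "u \<in> ?S" "\<And>y. y \<in> ?S \<Longrightarrow> N u \<le> N y"
    using continuous_attains_inf[OF compact_sphere ne is_norm_continuous_on[OF N]] by blast
  obtain v where v: "v \<in> ?S" "\<And>y. y \<in> ?S \<Longrightarrow> N y \<le> N v"
    using continuous_attains_sup[OF compact_sphere ne is_norm_continuous_on[OF N]] by blast
  have pos: "0 < N w" if "w \<in> ?S" for w
    using that is_normD(1,2)[OF N, of w] by (auto simp: order_less_le)
  have N_sgn: "N x = N (sgn x) * norm x" for x
    using is_normD(3)[OF N, of "norm x" "sgn x"] is_normD(2)[OF N, of 0]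
    by (cases "x = 0") (simp_all add: sgn_div_norm)
  have in_S: "sgn x \<in> ?S" if "x \<noteq> 0" for x :: 'a
    using that by (simp add: norm_sgn)
  show thesis
  proof
    show "0 < N u" "0 < N v"
      using pos u v by auto
    show "N u * norm x \<le> N x" "N x \<le> N v * norm x" for x
      using u(2)[OF in_S] v(2)[OF in_S] N_sgn[of x]
      by (cases "x = 0"; simp add: mult_right_mono)+
  qed
qed

lemma convex_body_unit_ball:
  fixes N :: "'a::euclidean_space \<Rightarrow> real"
  assumes N: "is_norm N"
  shows "convex_body {x. N x \<le> 1}"
proof -
  obtain a b where ab: "0 < a" "0 < b" "\<And>x. a * norm x \<le> N x" "\<And>x. N x \<le> b * norm x"
    using is_norm_equivalent_norm[OF N] by metis
  have "norm x \<le> 1 / a" if "N x \<le> 1" for x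
    using ab(3)[of x] that ab(1) by (simp add: field_simps)
  then have "bounded {x. N x \<le> 1}"
    by (auto intro: boundedI)
  moreover have "closed {x. N x \<le> 1}"
    by (rule closed_Collect_le[OF is_norm_continuous_on[OF N] continuous_on_const])
  moreover have "convex {x. N x \<le> 1}"
  proof (rule convexI)
    fix x y and u v :: real
    assume xy: "x \<in> {x. N x \<le> 1}" "y \<in> {x. N x \<le> 1}" and uv: "0 \<le> u" "0 \<le> v" "u + v = 1"
    have "N (u *\<^sub>R x + v *\<^sub>R y) \<le> u * N x + v * N y"
      using is_normD(4)[OF N, of "u *\<^sub>R x" "v *\<^sub>R y"] uv by (simp add: is_normD(3)[OF N])
    also have "\<dots> \<le> 1"
      using convex_bound_le[of "N x" 1 "N y" u v] xy uv by simp
    finally show "u *\<^sub>R x + v *\<^sub>R y \<in> {x. N x \<le> 1}" by simp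
  qed
  moreover have "0 \<in> interior {x. N x \<le> 1}"
  proof (rule interiorI)
    show "open {x. N x < 1}"
      by (rule open_Collect_less[OF is_norm_continuous_on[OF N] continuous_on_const])
  qed (use is_normD(2)[OF N, of 0] in auto)
  ultimately show ?thesis
    unfolding convex_body_def compact_eq_bounded_closed by auto
qed

section \<open>Interiors of convex sets and limits of nested compact sets\<close>

lemma interior_convex_nonempty:
  fixes S :: "'a::euclidean_space set"
  assumes "convex S" "0 \<in> S" "span S = UNIV"
  shows "interior S \<noteq> {}"
proof -
  \<comment> \<open>Because \<open>0 \<in> S\<close>, the affine hull of \<open>S\<close> is its
    span. A full affine hull makes interior and relative interior agree, and the latter is nonempty
    for a nonempty convex set.\<close>
  have "affine hull S = UNIV"
    using affine_hull_span_0[of S] assms hull_inc[of 0 S] by simp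
  then have "rel_interior S = interior S"
    by (rule rel_interior_interior)
  then show ?thesis
    using rel_interior_eq_empty[OF assms(1)] assms(2) by auto
qed

text \<open>The uniform approximation in the second conclusion yields the convergence in the first;
  it is also the form in which the equation of the limit body is derived.\<close>

lemma hausdorff_dist_nest:
  fixes F :: "nat \<Rightarrow> 'a::heine_borel set"
  assumes compact: "\<And>n. compact (F n)" and ne: "\<And>n. F n \<noteq> {}" and dec: "decseq F"
  shows "(\<lambda>n. hausdorff_dist (F n) (\<Inter>n. F n)) \<longlonglongrightarrow> 0"
    and "\<And>e. 0 < e \<Longrightarrow> \<exists>n. \<forall>x\<in>F n. infdist x (\<Inter>n. F n) < e"
proof -
  let ?M = "\<Inter>n. F n"
  have M_ne: "?M \<noteq> {}"
    using compact_nest[of F, OF compact ne] decseqD[OF dec] by blast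
  show near: "\<exists>n. \<forall>x\<in>F n. infdist x ?M < e" if "0 < e" for e
  proof (rule ccontr)
    assume far: "\<not> ?thesis"
    \<comment> \<open>The points of \<open>F n\<close> at distance at least \<open>e\<close> from
      the intersection form a nested family of compact sets. If none of these is empty, they share a
      point; it lies in the intersection and so has distance 0 from it.\<close>
    define G where "G n = F n \<inter> {x. e \<le> infdist x ?M}" for n
    have "closed {x. e \<le> infdist x ?M}"
      by (intro closed_Collect_le continuous_intros)
    then have "\<And>n. compact (G n)"
      unfolding G_def using compact by (intro compact_Int_closed)
    moreover have "\<And>n. G n \<noteq> {}"
      using far by (auto simp: G_def not_less)
    moreover have "\<And>k n. k \<le> n \<Longrightarrow> G n \<subseteq> G k"
      using dec by (auto simp: G_def decseq_def)
    ultimately have "(\<Inter>n. G n) \<noteq> {}"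
      by (rule compact_nest)
    then obtain x where "x \<in> ?M" "e \<le> infdist x ?M"
      by (auto simp: G_def)
    then show False
      using \<open>0 < e\<close> by simp
  qed
  have inner: "(SUP y\<in>?M. infdist y (F n)) = 0" for n
  proof -
    have "(SUP y\<in>?M. infdist y (F n)) = (SUP y\<in>?M. 0)"
      by (rule SUP_cong) auto
    then show ?thesis
      using M_ne by simp
  qed
  show "(\<lambda>n. hausdorff_dist (F n) ?M) \<longlonglongrightarrow> 0"
  proof (rule LIMSEQ_I)
    fix r :: real
    assume "0 < r"
    \<comment> \<open>Halving \<open>r\<close> absorbs the loss of strictness when passing to the
      supremum.\<close>
    then obtain n where n: "\<forall>x\<in>F n. infdist x ?M < r / 2"
      using near[of "r / 2"] by auto
    have "norm (hausdorff_dist (F k) ?M - 0) < r" if "n \<le> k" for k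
    proof -
      have "F k \<subseteq> F n"
        using dec that by (auto simp: decseq_def)
      then have "(SUP x\<in>F k. infdist x ?M) \<le> r / 2"
        using n by (intro cSUP_least ne) (auto intro: less_imp_le)
      then show ?thesis
        using \<open>0 < r\<close> inner[of k] by (simp add: hausdorff_dist_def)
    qed
    then show "\<exists>n. \<forall>k\<ge>n. norm (hausdorff_dist (F k) ?M - 0) < r"
      by blast
  qed
qed

section \<open>Upper bounds for the joint spectral radius\<close>

lemma matrix_word_append:
  "matrix_word A (xs @ ys) = matrix_word A ys ** matrix_word A xs"
  by (induction xs) (auto simp: matrix_mul_assoc)

text \<open>The constant \<open>K\<close> disappears in the limit because \<open>root n K\<close>
  tends to 1.\<close>

lemma joint_spectral_radius_le_onorm:
  fixes A :: "nat \<Rightarrow> real^'d^'d"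
  assumes "1 \<le> m" "0 < K" "0 \<le> c"
    and le: "\<And>\<sigma>. set \<sigma> \<subseteq> {1..m} \<Longrightarrow> onorm (\<lambda>x. matrix_word A \<sigma> *v x) \<le> K * c ^ length \<sigma>"
  shows "joint_spectral_radius m A \<le> c"
proof -
  let ?W = "\<lambda>n. {\<sigma>. length \<sigma> = n \<and> set \<sigma> \<subseteq> {1..m}}"
  let ?f = "\<lambda>n. Max ((\<lambda>\<sigma>. root n (onorm (\<lambda>x. matrix_word A \<sigma> *v x))) ` ?W n)"
  have fin: "finite (?W n)" for n
    using finite_lists_length_eq[of "{1..m}" n] by (simp add: conj_commute)
  have ne: "?W n \<noteq> {}" for n
    using assms(1) by (auto intro!: exI[of _ "replicate n 1"])
  have f_le: "?f n \<le> root n K * c" if "0 < n" for n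
  proof (rule Max.boundedI)
    fix r
    assume "r \<in> (\<lambda>\<sigma>. root n (onorm (\<lambda>x. matrix_word A \<sigma> *v x))) ` ?W n"
    then obtain \<sigma> where \<sigma>: "length \<sigma> = n" "set \<sigma> \<subseteq> {1..m}"
      and r: "r = root n (onorm (\<lambda>x. matrix_word A \<sigma> *v x))"
      by auto
    have "r \<le> root n (K * c ^ n)"
      using le[OF \<sigma>(2)] \<sigma>(1) that r by simp
    also have "\<dots> = root n K * c"
      using that assms(3) by (simp add: real_root_mult real_root_power_cancel)
    finally show "r \<le> root n K * c" .
  qed (use fin ne in auto)
  have "(\<lambda>n. root n K * c) \<longlonglongrightarrow> 1 * c"
    by (intro tendsto_mult tendsto_const LIMSEQ_root_const assms(2))
  then have "(\<lambda>n. ereal (root n K * c)) \<longlonglongrightarrow> ereal c"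
    by simp
  then have "limsup (\<lambda>n. ereal (root n K * c)) = ereal c"
    by (intro lim_imp_Limsup) auto
  moreover have "limsup (\<lambda>n. ereal (?f n)) \<le> limsup (\<lambda>n. ereal (root n K * c))"
  proof (rule Limsup_mono)
    show "\<forall>\<^sub>F n in sequentially. ereal (?f n) \<le> ereal (root n K * c)"
      using eventually_gt_at_top[of 0] by eventually_elim (use f_le in simp)
  qed
  ultimately have "limsup (\<lambda>n. ereal (?f n)) \<le> ereal c"
    by simp
  \<comment> \<open>\<open>real_of_ereal\<close> sends both infinities to 0: the upper bound
    excludes plus infinity, and for minus infinity the claim becomes
    \<open>0 \<le> c\<close>.\<close>
  then show ?thesis
    unfolding joint_spectral_radius_def using assms(3)
    by (cases "limsup (\<lambda>n. ereal (?f n))") auto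
qed

text \<open>Words of a single length \<open>n\<close> decide: a long word is cut into blocks of
  length \<open>n\<close>, each costing \<open>c ^ n\<close>, and the fewer than \<open>n\<close>
  remaining letters cost only a bounded extra factor.\<close>

lemma joint_spectral_radius_le:
  fixes A :: "nat \<Rightarrow> real^'d^'d"
  assumes "1 \<le> m" and N: "is_norm N" and "0 < c" and "0 < n"
    and step: "\<And>i x. i \<in> {1..m} \<Longrightarrow> N (A i *v x) \<le> R * N x"
    and word: "\<And>\<sigma> x. \<lbrakk>length \<sigma> = n; set \<sigma> \<subseteq> {1..m}\<rbrakk> \<Longrightarrow> N (matrix_word A \<sigma> *v x) \<le> c ^ n * N x"
  shows "joint_spectral_radius m A \<le> c"
proof -
  \<comment> \<open>\<open>T\<close> is the excess of a single letter over the rate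
    \<open>c\<close>; since \<open>1 \<le> T\<close>, the excess of an incomplete block is at most
    \<open>T ^ n\<close>.\<close>
  define T where "T = max 1 (R / c)"
  have T: "1 \<le> T" "R \<le> c * T"
    using \<open>0 < c\<close> by (auto simp: T_def field_simps max_def)
  have short: "N (matrix_word A \<sigma> *v x) \<le> (c * T) ^ length \<sigma> * N x"
    if "set \<sigma> \<subseteq> {1..m}" for \<sigma> x
    using that
  proof (induction \<sigma> arbitrary: x)
    case (Cons s \<sigma>)
    have "N (A s *v x) \<le> c * T * N x"
      using step[of s x] Cons.prems mult_right_mono[OF T(2) is_normD(1)[OF N, of x]] by simp
    then have "(c * T) ^ length \<sigma> * N (A s *v x) \<le> (c * T) ^ length \<sigma> * (c * T * N x)"
      using \<open>0 < c\<close> T(1) by (intro mult_left_mono) auto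
    moreover have "N (matrix_word A \<sigma> *v (A s *v x)) \<le> (c * T) ^ length \<sigma> * N (A s *v x)"
      using Cons by simp
    ultimately show ?case
      by (simp add: matrix_vector_mul_assoc mult_ac)
  qed simp
  have long: "N (matrix_word A \<sigma> *v x) \<le> T ^ n * c ^ length \<sigma> * N x"
    if "set \<sigma> \<subseteq> {1..m}" for \<sigma> x
    using that
  proof (induction "length \<sigma>" arbitrary: \<sigma> x rule: less_induct)
    case less
    show ?case
    proof (cases "length \<sigma> < n")
      case True
      have "(c * T) ^ length \<sigma> \<le> T ^ n * c ^ length \<sigma>"
        using power_increasing[OF less_imp_le[OF True] T(1)] \<open>0 < c\<close>
        by (simp add: power_mult_distrib)
      then show ?thesis
        using short[OF less.prems, of x] mult_right_mono[OF _ is_normD(1)[OF N, of x]]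
        by (meson order_trans)
    next
      case False
      \<comment> \<open>The first letters act first, so the block \<open>take n \<sigma>\<close> is
        applied to \<open>x\<close> and the rest of the word, shorter because \<open>0 < n\<close>,
        to the result.\<close>
      define y where "y = matrix_word A (take n \<sigma>) *v x"
      have split: "matrix_word A \<sigma> *v x = matrix_word A (drop n \<sigma>) *v y"
        using matrix_word_append[of A "take n \<sigma>" "drop n \<sigma>"]
        by (simp add: y_def matrix_vector_mul_assoc)
      have "N (matrix_word A (drop n \<sigma>) *v y) \<le> T ^ n * c ^ length (drop n \<sigma>) * N y"
        using less.prems False \<open>0 < n\<close> set_drop_subset[of n \<sigma>] by (intro less.hyps) auto
      also have "\<dots> \<le> T ^ n * c ^ length (drop n \<sigma>) * (c ^ n * N x)"
        unfolding y_def using less.prems False \<open>0 < c\<close> T(1) set_take_subset[of n \<sigma>]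
        by (intro mult_left_mono word) auto
      also have "\<dots> = T ^ n * c ^ length \<sigma> * N x"
        using False power_add[of c "length \<sigma> - n" n] by simp
      finally show ?thesis
        by (simp add: split)
    qed
  qed
  obtain a b where ab: "0 < a" "0 < b" "\<And>x. a * norm x \<le> N x" "\<And>x. N x \<le> b * norm x"
    using is_norm_equivalent_norm[OF N] by metis
  show ?thesis
  proof (rule joint_spectral_radius_le_onorm[OF \<open>1 \<le> m\<close>])
    \<comment> \<open>\<open>T ^ n\<close> pays for the incomplete block, \<open>b / a\<close> for
      passing from \<open>N\<close> to the Euclidean norm.\<close>
    show "0 < b * T ^ n / a" "0 \<le> c"
      using ab T(1) \<open>0 < c\<close> by auto
    fix \<sigma> :: "nat list"
    assume \<sigma>: "set \<sigma> \<subseteq> {1..m}"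
    show "onorm (\<lambda>x. matrix_word A \<sigma> *v x) \<le> b * T ^ n / a * c ^ length \<sigma>"
    proof (rule onorm_le)
      fix x
      have "a * norm (matrix_word A \<sigma> *v x) \<le> T ^ n * c ^ length \<sigma> * N x"
        using ab(3) long[OF \<sigma>] by (meson order_trans)
      also have "\<dots> \<le> T ^ n * c ^ length \<sigma> * (b * norm x)"
        using ab(4) T(1) \<open>0 < c\<close> by (intro mult_left_mono) auto
      finally show "norm (matrix_word A \<sigma> *v x) \<le> b * T ^ n / a * c ^ length \<sigma> * norm x"
        using ab(1) by (simp add: field_simps)
    qed
  qed
qed

section \<open>Convex hulls of the images of a set\<close>

lemma conv_images_mono: "M \<subseteq> M' \<Longrightarrow> conv_images m A M \<subseteq> conv_images m A M'"
  unfolding conv_images_def by (intro hull_mono) blast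

lemma matrix_vector_mult_in_conv_images:
  "\<lbrakk>i \<in> {1..m}; x \<in> M\<rbrakk> \<Longrightarrow> A i *v x \<in> conv_images m A M"
  unfolding conv_images_def by (intro hull_inc) blast

lemma convex_conv_images: "convex (conv_images m A M)"
  unfolding conv_images_def by (rule convex_convex_hull)

lemma compact_conv_images: "compact M \<Longrightarrow> compact (conv_images m A M)"
  unfolding conv_images_def
  by (intro compact_convex_hull compact_UN finite_atLeastAtMost compact_continuous_image
      linear_continuous_on matrix_vector_mul_bounded_linear)

lemma zero_in_conv_images: "\<lbrakk>1 \<le> m; 0 \<in> M\<rbrakk> \<Longrightarrow> 0 \<in> conv_images m A M"
  using matrix_vector_mult_in_conv_images[of 1 m 0 M A] by simp

text \<open>The Minkowski sum of the convex set \<open>conv_images m A M\<close> and a ball of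
  radius \<open>C * e\<close> is convex and contains every image of a point of \<open>M'\<close>,
  hence also their hull.\<close>

lemma conv_images_thickening:
  fixes A :: "nat \<Rightarrow> real^'d^'d"
  assumes C: "\<And>i x. i \<in> {1..m} \<Longrightarrow> norm (A i *v x) \<le> C * norm x" and "0 \<le> C"
    and M': "\<And>x. x \<in> M' \<Longrightarrow> \<exists>y\<in>M. dist x y \<le> e" and z: "z \<in> conv_images m A M'"
  shows "\<exists>y\<in>conv_images m A M. dist z y \<le> C * e"
proof -
  let ?T = "\<Union>y\<in>conv_images m A M. \<Union>v\<in>cball 0 (C * e). {y + v}"
  have "(\<Union>i\<in>{1..m}. (\<lambda>x. A i *v x) ` M') \<subseteq> ?T"
  proof clarify
    fix i x
    assume i: "i \<in> {1..m}" and "x \<in> M'"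
    then obtain y where y: "y \<in> M" "dist x y \<le> e"
      using M' by blast
    have "norm (A i *v (x - y)) \<le> C * e"
      using C[OF i, of "x - y"] y(2) \<open>0 \<le> C\<close> mult_left_mono[of "norm (x - y)" e C]
      by (simp add: dist_norm)
    moreover have "A i *v x = A i *v y + A i *v (x - y)"
      by (simp add: matrix_vector_mult_diff_distrib)
    ultimately show "A i *v x \<in> ?T"
      using matrix_vector_mult_in_conv_images[of i m y M A] i y(1) by force
  qed
  moreover have "convex ?T"
    using convex_sums[OF convex_conv_images convex_cball] .
  ultimately have "conv_images m A M' \<subseteq> ?T"
    unfolding conv_images_def[of m A M'] by (rule hull_minimal)
  then obtain y v where "y \<in> conv_images m A M" "norm v \<le> C * e" "z = y + v"
    using z by auto
  then show ?thesis
    by (intro bexI[of _ y]) (auto simp: dist_norm)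
qed

text \<open>Checking generators suffices by linearity. With \<open>S = T\<close> this is invariance
  of a span; distinct sets allow comparing a set with the hull of its images.\<close>

lemma invariant_span:
  fixes B :: "real^'d^'d"
  assumes "\<And>x. x \<in> S \<Longrightarrow> B *v x \<in> span T" "x \<in> span S"
  shows "B *v x \<in> span T"
proof -
  have "(*v) B ` span S = span ((*v) B ` S)"
    by (rule linear_span_image[symmetric]) simp
  also have "\<dots> \<subseteq> span T"
    using assms(1) by (intro span_minimal subspace_span) blast
  finally show ?thesis
    using assms(2) by blast
qed

section \<open>The decreasing sequence of bodies\<close>

locale extremal_family =
  fixes A :: "nat \<Rightarrow> real^'d^'d" and m :: nat and N :: "real^'d \<Rightarrow> real"
  assumes m: "1 \<le> m"
    and irreducible: "irreducible_matrices (A ` {1..m})"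
    and jsr_pos: "0 < joint_spectral_radius m A"
    and extremal: "extremal_norm m A N"
begin

abbreviation "\<rho> \<equiv> joint_spectral_radius m A"
abbreviation "M \<equiv> body_seq m A N"

lemma N: "is_norm N"
  using extremal by (simp add: extremal_norm_def)

lemma extremal_bound: "i \<in> {1..m} \<Longrightarrow> N (A i *v x) \<le> \<rho> * N x"
proof -
  assume "i \<in> {1..m}"
  then have "N (A i *v x) \<le> Max ((\<lambda>i. N (A i *v x)) ` {1..m})"
    by (intro Max_ge) auto
  then show ?thesis
    using extremal unfolding extremal_norm_def by (meson order_trans)
qed

lemma in_body_seq_Suc: "x \<in> M (Suc n) \<longleftrightarrow> \<rho> *\<^sub>R x \<in> conv_images m A (M n)"
  using jsr_pos by (auto simp: image_iff intro!: bexI[of _ "\<rho> *\<^sub>R x"])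

text \<open>As \<open>S\<close> spans the space, the span of the hull contains the full range of
  every \<open>A i\<close> and is therefore invariant. By irreducibility it could only fail by being
  \<open>{0}\<close>, but then all matrices vanish, against \<open>0 < \<rho>\<close>.\<close>

lemma span_conv_images:
  assumes "span S = UNIV"
  shows "span (conv_images m A S) = UNIV"
proof -
  let ?W = "span (conv_images m A S)"
  have inv: "A i *v x \<in> ?W" if "i \<in> {1..m}" for i x
  proof (rule invariant_span)
    show "A i *v y \<in> ?W" if "y \<in> S" for y
      using matrix_vector_mult_in_conv_images[OF \<open>i \<in> {1..m}\<close> that] by (rule span_base)
  qed (use assms in simp)
  have "?W \<noteq> {0}"
  proof
    assume "?W = {0}"
    then have zero: "A i *v x = 0" if "i \<in> {1..m}" for i x
      using inv[OF that] by simp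
    \<comment> \<open>The rate must be positive and below \<rho>; any such number would serve in
      place of \<open>\<rho> / 2\<close>.\<close>
    have half: "N (A i *v x) \<le> \<rho> / 2 * N x" if "i \<in> {1..m}" for i x
      using zero[OF that] is_normD(2)[OF N, of 0] is_normD(1)[OF N, of x] jsr_pos by simp
    have "\<rho> \<le> \<rho> / 2"
    proof (rule joint_spectral_radius_le[OF m N, where n = 1])
      fix \<sigma> :: "nat list" and x
      assume "length \<sigma> = 1" "set \<sigma> \<subseteq> {1..m}"
      then show "N (matrix_word A \<sigma> *v x) \<le> (\<rho> / 2) ^ 1 * N x"
        using half by (auto simp: length_Suc_conv)
    next
      show "N (A i *v x) \<le> \<rho> / 2 * N x" if "i \<in> {1..m}" for i x
        using half[OF that] .
    qed (use jsr_pos in auto)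
    then show False
      using jsr_pos by simp
  qed
  moreover have "?W = {0} \<or> ?W = UNIV"
    using irreducible inv unfolding irreducible_matrices_def by (auto simp: image_subset_iff)
  ultimately show ?thesis
    by blast
qed

text \<open>The matrices may be singular, so nonempty interior is not passed on by the single
  images. The induction carries the spanning property instead, which irreducibility
  preserves.\<close>

lemma body_seq_nondegenerate:
  "compact (M n) \<and> convex (M n) \<and> 0 \<in> M n \<and> span (M n) = UNIV"
proof (induction n)
  case 0
  have "convex_body (M 0)"
    using convex_body_unit_ball[OF N] by simp
  \<comment> \<open>A set of lower dimension has empty interior.\<close>
  moreover from this have "span (M 0) = UNIV"
    unfolding convex_body_def
    by (metis dim_eq_full dim_span empty_interior_lowdim le_neq_implies_less dim_subset_UNIV)
  ultimately show ?case
    using is_normD(2)[OF N, of 0] by (simp add: convex_body_def)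
next
  case (Suc n)
  have "compact (M (Suc n))" "convex (M (Suc n))"
    using Suc by (simp_all add: compact_scaling convex_scaling compact_conv_images convex_conv_images)
  moreover have "0 \<in> M (Suc n)"
    using zero_in_conv_images[OF m, of "M n" A] Suc by (simp add: in_body_seq_Suc del: body_seq.simps)
  moreover have "span (M (Suc n)) = UNIV"
  proof -
    have "conv_images m A (M n) \<subseteq> span (M (Suc n))"
    proof
      fix y
      assume "y \<in> conv_images m A (M n)"
      then have "(1 / \<rho>) *\<^sub>R y \<in> M (Suc n)"
        by (simp only: body_seq.simps imageI)
      then have "\<rho> *\<^sub>R (1 / \<rho>) *\<^sub>R y \<in> span (M (Suc n))"
        by (intro span_scale span_base)
      then show "y \<in> span (M (Suc n))"
        using jsr_pos by simp
    qed
    then have "span (conv_images m A (M n)) \<subseteq> span (M (Suc n))"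
      by (intro span_minimal subspace_span)
    then show ?thesis
      using span_conv_images Suc by blast
  qed
  ultimately show ?case
    by blast
qed

lemma convex_body_body_seq: "convex_body (M n)"
  using body_seq_nondegenerate[of n] interior_convex_nonempty[of "M n"]
  by (simp add: convex_body_def)

text \<open>Extremality enters in the base case: \<rho> times the unit ball is convex and contains
  all images of the ball. Monotonicity of the hull operation does the rest.\<close>

lemma body_seq_Suc_subset: "M (Suc n) \<subseteq> M n"
proof (induction n)
  case 0
  have "convex ((\<lambda>x. \<rho> *\<^sub>R x) ` M 0)"
    using body_seq_nondegenerate[of 0] by (intro convex_scaling) auto
  moreover have "A i *v x \<in> (\<lambda>x. \<rho> *\<^sub>R x) ` M 0" if "i \<in> {1..m}" "x \<in> M 0" for i x
  proof (rule image_eqI)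
    show "A i *v x = \<rho> *\<^sub>R ((1 / \<rho>) *\<^sub>R (A i *v x))"
      using jsr_pos by simp
    have "N (A i *v x) \<le> \<rho>"
      using extremal_bound[OF that(1), of x] that(2) jsr_pos mult_left_mono[of "N x" 1 \<rho>]
      unfolding body_seq.simps mem_Collect_eq by linarith
    then show "(1 / \<rho>) *\<^sub>R (A i *v x) \<in> M 0"
      using jsr_pos by (simp only: body_seq.simps mem_Collect_eq is_normD(3)[OF N]) (simp add: field_simps)
  qed
  ultimately have "conv_images m A (M 0) \<subseteq> (\<lambda>x. \<rho> *\<^sub>R x) ` M 0"
    unfolding conv_images_def by (intro hull_minimal) auto
  then show ?case
    using jsr_pos by (fastforce simp: in_body_seq_Suc simp del: body_seq.simps)
next
  case (Suc n)
  then show ?case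
    using conv_images_mono[OF Suc, of m A] by (auto simp: in_body_seq_Suc simp del: body_seq.simps)
qed

lemma decseq_body_seq: "decseq M"
  using body_seq_Suc_subset by (intro decseq_SucI)

section \<open>The limit body and its equation\<close>

definition "M_lim = (\<Inter>n. M n)"

lemma M_lim_subset: "M_lim \<subseteq> M n"
  unfolding M_lim_def by blast

lemma compact_M_lim: "compact M_lim"
  unfolding M_lim_def using body_seq_nondegenerate by (intro compact_Inter) auto

lemma convex_M_lim: "convex M_lim"
  unfolding M_lim_def using body_seq_nondegenerate by (intro convex_INT) auto

lemma zero_in_M_lim: "0 \<in> M_lim"
  unfolding M_lim_def using body_seq_nondegenerate by blast

lemma hausdorff_dist_M_lim: "(\<lambda>n. hausdorff_dist (M n) M_lim) \<longlonglongrightarrow> 0"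
  unfolding M_lim_def using body_seq_nondegenerate
  by (intro hausdorff_dist_nest(1) decseq_body_seq) auto

lemma body_seq_near_M_lim:
  assumes "0 < e"
  obtains n where "\<And>x. x \<in> M n \<Longrightarrow> \<exists>y\<in>M_lim. dist x y \<le> e"
proof -
  obtain n where n: "\<forall>x\<in>M n. infdist x M_lim < e"
    using hausdorff_dist_nest(2)[of M, OF _ _ decseq_body_seq assms] body_seq_nondegenerate
    unfolding M_lim_def by blast
  have "\<exists>y\<in>M_lim. dist x y \<le> e" if "x \<in> M n" for x
  proof -
    obtain y where "y \<in> M_lim" "infdist x M_lim = dist x y"
      using infdist_attains_inf[OF compact_imp_closed[OF compact_M_lim]] zero_in_M_lim by blast
    then show ?thesis
      using n that by force
  qed
  then show thesis
    using that by blast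
qed

lemma scaled_M_lim: "(\<lambda>x. \<rho> *\<^sub>R x) ` M_lim = conv_images m A M_lim"
proof (intro equalityI subsetI)
  fix z
  assume z: "z \<in> conv_images m A M_lim"
  \<comment> \<open>Only the bodies with positive index are reached here; \<open>M 0\<close> follows
    because the sequence decreases.\<close>
  have "(1 / \<rho>) *\<^sub>R z \<in> M (Suc n)" for n
    using z conv_images_mono[OF M_lim_subset] by (auto simp: subset_iff)
  then have "(1 / \<rho>) *\<^sub>R z \<in> M_lim"
    unfolding M_lim_def using body_seq_Suc_subset by blast
  then show "z \<in> (\<lambda>x. \<rho> *\<^sub>R x) ` M_lim"
    using jsr_pos by (intro image_eqI[of _ _ "(1 / \<rho>) *\<^sub>R z"]) auto
next
  fix z
  assume "z \<in> (\<lambda>x. \<rho> *\<^sub>R x) ` M_lim"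
  then have z: "z \<in> conv_images m A (M n)" for n
    using M_lim_subset[of "Suc n"] by (auto simp: in_body_seq_Suc simp del: body_seq.simps)
  \<comment> \<open>A common Lipschitz constant of all the matrices; the summand 1 keeps it
    positive, so that one may divide by it.\<close>
  define C where "C = 1 + (\<Sum>i=1..m. onorm ((*v) (A i)))"
  have C_pos: "1 \<le> C"
    unfolding C_def by (simp add: sum_nonneg onorm_pos_le)
  have C: "norm (A i *v x) \<le> C * norm x" if "i \<in> {1..m}" for i x
  proof -
    have "onorm ((*v) (A i)) \<le> (\<Sum>i=1..m. onorm ((*v) (A i)))"
      using that by (intro member_le_sum) (auto intro: onorm_pos_le)
    then have "onorm ((*v) (A i)) * norm x \<le> C * norm x"
      unfolding C_def by (intro mult_right_mono) auto
    then show ?thesis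
      using onorm[of "(*v) (A i)" x] by simp
  qed
  \<comment> \<open>The hull is compact, hence closed, so approximating \<open>z\<close> by its
    points is enough.\<close>
  have "z \<in> closure (conv_images m A M_lim)"
    unfolding closure_approachable_le
  proof (intro allI impI)
    fix e :: real
    assume "0 < e"
    then obtain n where n: "\<And>x. x \<in> M n \<Longrightarrow> \<exists>y\<in>M_lim. dist x y \<le> e / C"
      using body_seq_near_M_lim[of "e / C"] C_pos by auto
    have "\<exists>y\<in>conv_images m A M_lim. dist z y \<le> C * (e / C)"
      by (rule conv_images_thickening[OF C _ n z]) (use C_pos in auto)
    then show "\<exists>y\<in>conv_images m A M_lim. dist y z \<le> e"
      using C_pos by (simp add: dist_commute)
  qed
  then show "z \<in> conv_images m A M_lim"
    using closure_closed[OF compact_imp_closed[OF compact_conv_images[OF compact_M_lim]]] by simp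
qed

section \<open>The limit body has nonempty interior\<close>

lemma matrix_word_in_body_seq:
  assumes "set \<sigma> \<subseteq> {1..m}" "N x \<le> 1"
  shows "(1 / \<rho> ^ length \<sigma>) *\<^sub>R (matrix_word A \<sigma> *v x) \<in> M (length \<sigma>)"
  using assms(1)
\<comment> \<open>The last letter of a word acts last, just as the recursion for the bodies applies
  its newest matrix outermost; hence induction from the right.\<close>
proof (induction \<sigma> rule: rev_induct)
  case Nil
  then show ?case
    using assms(2) by simp
next
  case (snoc s \<sigma>)
  have "A s *v ((1 / \<rho> ^ length \<sigma>) *\<^sub>R (matrix_word A \<sigma> *v x)) \<in> conv_images m A (M (length \<sigma>))"
    using snoc by (intro matrix_vector_mult_in_conv_images) auto
  moreover have "A s *v ((1 / \<rho> ^ length \<sigma>) *\<^sub>R (matrix_word A \<sigma> *v x))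
      = \<rho> *\<^sub>R (1 / \<rho> ^ length (\<sigma> @ [s])) *\<^sub>R (matrix_word A (\<sigma> @ [s]) *v x)"
    using jsr_pos
    by (simp add: matrix_word_append matrix_vector_mul_assoc matrix_vector_mult_scaleR)
  ultimately show ?case
    by (simp add: in_body_seq_Suc del: body_seq.simps)
qed

text \<open>A contraction by 1/2 relative to \<open>\<rho> ^ k\<close>, uniform over all words of
  length \<open>k\<close>, amounts to a rate \<open>\<rho> * t\<close> with \<open>t < 1\<close>,
  which is impossible for the joint spectral radius.\<close>

lemma M_lim_nontrivial: "M_lim \<noteq> {0}"
proof
  assume trivial: "M_lim = {0}"
  obtain a b where ab: "0 < a" "0 < b" "\<And>x. a * norm x \<le> N x" "\<And>x. N x \<le> b * norm x"
    using is_norm_equivalent_norm[OF N] by metis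
  \<comment> \<open>This Euclidean radius is chosen so that \<open>N x \<le> b * norm x\<close>
    gives at most 1/2.\<close>
  obtain n where n: "\<And>x. x \<in> M n \<Longrightarrow> norm x \<le> 1 / (2 * b)"
    using body_seq_near_M_lim[of "1 / (2 * b)"] ab(2) trivial by auto
  \<comment> \<open>The word length has to be positive; the successor ensures this, and
    \<open>M k\<close> still lies in \<open>M n\<close>.\<close>
  define k where "k = Suc n"
  have half: "N x \<le> 1 / 2" if "x \<in> M k" for x
  proof -
    have "norm x \<le> 1 / (2 * b)"
      using n that body_seq_Suc_subset[of n] unfolding k_def by blast
    then have "b * norm x \<le> b * (1 / (2 * b))"
      using ab(2) by (intro mult_left_mono) auto
    then show ?thesis
      using ab(2) ab(4)[of x] by simp
  qed
  \<comment> \<open>Chosen so that \<open>(\<rho> * t) ^ k\<close> is half of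
    \<open>\<rho> ^ k\<close>.\<close>
  define t where "t = root k (1 / 2)"
  have t: "0 < t" "t < 1" "t ^ k = 1 / 2"
    unfolding t_def k_def by (simp_all del: power_Suc)
  have "\<rho> \<le> \<rho> * t"
  proof (rule joint_spectral_radius_le[OF m N])
    show "0 < \<rho> * t" "0 < k"
      using jsr_pos t(1) by (auto simp: k_def)
    show "N (A i *v x) \<le> \<rho> * N x" if "i \<in> {1..m}" for i x
      using that by (rule extremal_bound)
    fix \<sigma> :: "nat list" and x
    assume \<sigma>: "length \<sigma> = k" "set \<sigma> \<subseteq> {1..m}"
    show "N (matrix_word A \<sigma> *v x) \<le> (\<rho> * t) ^ k * N x"
    proof (cases "x = 0")
      case True
      then show ?thesis
        using is_normD(2)[OF N, of 0] by simp
    next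
      case False
      then have Nx: "0 < N x"
        using is_normD(1,2)[OF N, of x] by (auto simp: order_less_le)
      \<comment> \<open>Normalising \<open>x\<close> places it in the unit ball \<open>M 0\<close>,
        so its scaled image under the word lies in \<open>M k\<close>.\<close>
      have "N ((1 / N x) *\<^sub>R x) \<le> 1"
        using Nx by (simp only: is_normD(3)[OF N]) simp
      then have "(1 / \<rho> ^ k) *\<^sub>R (matrix_word A \<sigma> *v ((1 / N x) *\<^sub>R x)) \<in> M k"
        using matrix_word_in_body_seq[OF \<sigma>(2)] \<sigma>(1) by blast
      then have "N ((1 / \<rho> ^ k) *\<^sub>R (1 / N x) *\<^sub>R (matrix_word A \<sigma> *v x)) \<le> 1 / 2"
        using half by (simp only: matrix_vector_mult_scaleR)
      then have "N (matrix_word A \<sigma> *v x) / (\<rho> ^ k * N x) \<le> 1 / 2"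
        using jsr_pos Nx by (simp only: is_normD(3)[OF N]) simp
      then show ?thesis
        using jsr_pos Nx by (simp add: power_mult_distrib t(3) field_simps)
    qed
  qed
  then show False
    using jsr_pos t(2) by simp
qed

lemma DK_body_M_lim: "DK_body m A M_lim"
proof -
  have "A i *v x \<in> span M_lim" if "i \<in> {1..m}" "x \<in> span M_lim" for i x
  proof (rule invariant_span[OF _ that(2)])
    fix y
    assume "y \<in> M_lim"
    \<comment> \<open>The equation of the limit body makes its span invariant: each
      \<open>A i *v y\<close> is \<rho> times a point of \<open>M_lim\<close>.\<close>
    then have "A i *v y \<in> (\<lambda>x. \<rho> *\<^sub>R x) ` M_lim"
      using matrix_vector_mult_in_conv_images[OF that(1)] by (simp add: scaled_M_lim)
    then show "A i *v y \<in> span M_lim"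
      by (auto intro: span_mul[OF span_base])
  qed
  then have "span M_lim = {0} \<or> span M_lim = UNIV"
    using irreducible unfolding irreducible_matrices_def by (auto simp: image_subset_iff)
  moreover have "span M_lim \<noteq> {0}"
    using M_lim_nontrivial zero_in_M_lim span_superset[of M_lim] by auto
  ultimately have "interior M_lim \<noteq> {}"
    by (intro interior_convex_nonempty convex_M_lim zero_in_M_lim) auto
  then show ?thesis
    unfolding DK_body_def convex_body_def
    using compact_M_lim convex_M_lim scaled_M_lim jsr_pos by blast
qed

end

theorem lemma4p5:
  fixes A :: "nat \<Rightarrow> real^'d^'d" and m :: nat and N :: "real^'d \<Rightarrow> real"
  assumes "m \<ge> 1"
    and "irreducible_matrices (A ` {1..m})"
    and "joint_spectral_radius m A > 0"
    and "extremal_norm m A N"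
  shows "(\<forall>n. convex_body (body_seq m A N n)) \<and>
    (\<forall>n. body_seq m A N (Suc n) \<subseteq> body_seq m A N n) \<and>
    (\<exists>M. DK_body m A M \<and> (\<lambda>n. hausdorff_dist (body_seq m A N n) M) \<longlonglongrightarrow> 0)"
proof -
  interpret extremal_family A m N
    using assms by unfold_locales
  show ?thesis
    using convex_body_body_seq body_seq_Suc_subset DK_body_M_lim hausdorff_dist_M_lim by blast
qed

end
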